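(* Let $h\geq 2$ be an integer, let $m_0=2h(2h-1)$, $m_1=(2h+1)(2h-1)$, $m_2=2h(2h+1)$, $m_3=2h(2h+1)+(2h-1)$, and let $\Gamma_h=\langle m_0,m_1,m_2,m_3\rangle$. The Apéry table $\mathrm{AT}(\Gamma_h,m_0)$ is a matrix of order $2h\times m_0$ and (with the columns arranged in the order below) is the block matrix $$\mathrm{AT}(\Gamma_h,m_0)=\begin{bmatrix}\mathcal{T}_0&\mathcal{T}_1&\mathcal{T}_2&\mathcal{T}_3&\mathcal{T}_4&\mathcal{T}_5\end{bmatrix},$$ where (rows numbered $1,\dots,2h$): (a) $\mathcal{T}_0=(t^{(0)}_{i1})$ is $2h\times 1$ with $t^{(0)}_{i1}=(i-1)m_0$ for $1\leq i\leq 2h$. (b) $\mathcal{T}_1=(t^{(1)}_{ij})$ is $2h\times(2h-1)$ with, for $1\leq j\leq 2h-1$, $t^{(1)}_{ij}=jm_1$ if $1\leq i\leq j+1$ and $t^{(1)}_{ij}=jm_1+(i-j-1)m_0$ if $j+1<i\leq 2h$. (c) For $l=2,3$, $\mathcal{T}_l=(t^{(l)}_{ij})$ is $2h\times(2h-2)$ with, for $1\leq j\leq 2h-2$, $t^{(l)}_{ij}=jm_l$ if $1\leq i\leq j+1$ and $t^{(l)}_{ij}=jm_l+(i-j-1)m_0$ if $j+1<i\leq 2h$. (d) $\mathcal{T}_4=\begin{bmatrix}T^{(4)}_1&\cdots&T^{(4)}_{2h-2}\end{bmatrix}$ is $2h\times(h-1)(2h-1)$, where $T^{(4)}_i=(t^{(i4)}_{rs})$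 is $2h\times(2h-1-i)$ with, for $1\leq s\leq 2h-1-i$, $t^{(i4)}_{rs}=im_1+sm_3$ if $1\leq r\leq i+s+1$ and $t^{(i4)}_{rs}=im_1+sm_3+(r-i-s-1)m_0$ if $i+s+1<r\leq 2h$. (e) $\mathcal{T}_5=\begin{bmatrix}T^{(5)}_1&\cdots&T^{(5)}_{2h-3}\end{bmatrix}$ is $2h\times(h-1)(2h-3)$, where $T^{(5)}_i=(t^{(i5)}_{rs})$ is $2h\times(2h-2-i)$ with, for $1\leq s\leq 2h-2-i$, $t^{(i5)}_{rs}=im_2+sm_3$ if $1\leq r\leq i+s+1$ and $t^{(i5)}_{rs}=im_2+sm_3+(r-i-s-1)m_0$ if $i+s+1<r\leq 2h$.
   Context: $\langle a_1,\dots,a_e\rangle$ denotes the set of all non-negative integer combinations of $a_1,\dots,a_e$. Let $\Gamma$ be a numerical semigroup with smallest nonzero element $a$ (here $a=m_0$). The Apéry set is $\mathrm{Ap}(\Gamma,a)=\{s\in\Gamma\mid s-a\notin\Gamma\}$; it has $a$ elements, enumerated as $\omega_0=0,\omega_1,\dots,\omega_{a-1}$. Put $M=\Gamma\setminus\{0\}$ and $nM=M+\cdots+M$ ($n$ copies) for $n\geq 1$ (with $0M=\Gamma$). The reduction number is $r=\min\{r\mid (r+1)M=a+rM\}$. Define $\omega_{1,0}=a$ and $\omega_{1,i}=\omega_i$ for $1\leq i\leq a-1$, and inductively $\omega_{n+1,i}=\omega_{n,i}$ if $\omega_{n,i}\in(n+1)M$, and $\omega_{n+1,i}=\omega_{n,i}+a$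 otherwise. The Apéry table $\mathrm{AT}(\Gamma,a)$ is the $(r+1)\times a$ matrix with rows indexed by $0\leq s\leq r$ and columns by $0\leq t\leq a-1$, whose $(0,t)$ entry is $\omega_t$ and whose $(s,t)$ entry is $\omega_{s,t}$ for $1\leq s\leq r$; it depends on the enumeration of the Apéry set only through the order of its columns. In the claim rows are numbered from $1$, so row number $i$ there is row $s=i-1$ of this definition; the column order is the one given by the enumeration of $\mathrm{Ap}(\Gamma_h,m_0)$ appearing in the first row of the block matrix. *)

theory Defs
  imports "Jordan_Normal_Form.Matrix"
begin

definition nonneg_combinations :: "nat list \<Rightarrow> nat set" where
  "nonneg_combinations as = {\<Sum>i<length as. c i * as ! i | c :: nat \<Rightarrow> nat. True}"

definition numerical_semigroup :: "nat set \<Rightarrow> bool" where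
  "numerical_semigroup \<Gamma> \<longleftrightarrow>
     0 \<in> \<Gamma> \<and> (\<forall>x\<in>\<Gamma>. \<forall>y\<in>\<Gamma>. x + y \<in> \<Gamma>) \<and> finite (UNIV - \<Gamma>)"

definition multiplicity_of :: "nat set \<Rightarrow> nat" where
  "multiplicity_of \<Gamma> = (LEAST x. x \<in> \<Gamma> \<and> x \<noteq> 0)"

(* The difference s - a is taken in the integers: truncated subtraction would send
   every s < a to 0, which lies in the semigroup. *)
definition apery_set :: "nat set \<Rightarrow> nat \<Rightarrow> nat set" where
  "apery_set \<Gamma> a = {s \<in> \<Gamma>. int s - int a \<notin> int ` \<Gamma>}"

definition apery_enumeration :: "nat set \<Rightarrow> nat \<Rightarrow> (nat \<Rightarrow> nat) \<Rightarrow> bool" where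
  "apery_enumeration \<Gamma> a \<omega> \<longleftrightarrow> bij_betw \<omega> {..<a} (apery_set \<Gamma> a) \<and> \<omega> 0 = 0"

(* nM for M = \<Gamma> - {0}, with the convention 0M = \<Gamma> *)
definition ideal_multiple :: "nat set \<Rightarrow> nat \<Rightarrow> nat set" where
  "ideal_multiple \<Gamma> n =
     (if n = 0 then \<Gamma> else {sum_list xs | xs. length xs = n \<and> set xs \<subseteq> \<Gamma> - {0}})"

definition reduction_number :: "nat set \<Rightarrow> nat \<Rightarrow> nat" where
  "reduction_number \<Gamma> a =
     (LEAST r. ideal_multiple \<Gamma> (r + 1) = (\<lambda>x. a + x) ` ideal_multiple \<Gamma> r)"

(* The (s,t) entry of the table. Row 1 is not obtained from row 0 by the inductive rule:
   it is row 0 with its entry 0 replaced by a. *)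
fun apery_entry :: "nat set \<Rightarrow> nat \<Rightarrow> (nat \<Rightarrow> nat) \<Rightarrow> nat \<Rightarrow> nat \<Rightarrow> nat" where
  "apery_entry \<Gamma> a \<omega> 0 t = \<omega> t"
| "apery_entry \<Gamma> a \<omega> (Suc 0) t = (if t = 0 then a else \<omega> t)"
| "apery_entry \<Gamma> a \<omega> (Suc (Suc n)) t =
     (if apery_entry \<Gamma> a \<omega> (Suc n) t \<in> ideal_multiple \<Gamma> (Suc (Suc n))
      then apery_entry \<Gamma> a \<omega> (Suc n) t
      else apery_entry \<Gamma> a \<omega> (Suc n) t + a)"

definition apery_table :: "nat set \<Rightarrow> nat \<Rightarrow> (nat \<Rightarrow> nat) \<Rightarrow> nat mat" where
  "apery_table \<Gamma> a \<omega> =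
     mat (reduction_number \<Gamma> a + 1) a (\<lambda>(s, t). apery_entry \<Gamma> a \<omega> s t)"

(* f receives row and column numbers counted from 1, whereas mat counts from 0. *)
definition mat_from_1 :: "nat \<Rightarrow> nat \<Rightarrow> (nat \<Rightarrow> nat \<Rightarrow> 'a) \<Rightarrow> 'a mat" where
  "mat_from_1 nr nc f = mat nr nc (\<lambda>(i, j). f (i + 1) (j + 1))"

(* [A_1 ... A_n] for blocks A_i that all have nr rows *)
definition block_row :: "nat \<Rightarrow> 'a mat list \<Rightarrow> 'a mat" where
  "block_row nr As = mat_of_cols nr (concat (map cols As))"

end

theory Submission
  imports Defs "HOL-Number_Theory.Cong"
begin

text \<open>
  Put \<open>k = 2 h - 1\<close>. Then \<open>m0 = k (k + 1)\<close>, \<open>m1 = m0 + k\<close>, \<open>m2 = m0 + 2 (k + 1)\<close> and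
  \<open>m3 = m0 + k + 2 (k + 1)\<close>, so a sum of \<open>D\<close> generators has the form
  \<open>D m0 + p k + 2 (k + 1) q\<close>, where \<open>p\<close> counts the \<open>m1\<close> and \<open>m3\<close> and \<open>q\<close> counts the \<open>m2\<close> and \<open>m3\<close>,
  and the triples arising are those with \<open>p, q \<le> D\<close>. Since \<open>(k + 1) k = m0\<close> and
  \<open>2 (k + 1) k = 2 m0\<close>, one may reduce \<open>p\<close> modulo \<open>k + 1\<close> and \<open>q\<close> modulo \<open>k\<close>, which only increases \<open>D\<close>;
  as \<open>k\<close> is odd, the Chinese remainder theorem makes the reduced triple unique. Hence the reduced
  \<open>D\<close> is the largest \<open>n\<close> such that the element lies in \<open>nM\<close>, adding \<open>m0\<close> raises it by one, the
  Apery set consists of the triples with \<open>D = max p q\<close>, and the entry of the Apery table in row \<open>s\<close>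
  and column \<open>(p, q)\<close> is the triple with \<open>D = max s (max p q)\<close>.
\<close>

section \<open>Values of triples and their reduced form\<close>

definition mval :: "nat \<Rightarrow> nat \<Rightarrow> nat \<Rightarrow> nat \<Rightarrow> nat" where
  "mval k D p q = D * (k * (k + 1)) + p * k + 2 * (k + 1) * q"

text \<open>This will turn out to be \<open>nM\<close>, and for \<open>n = 0\<close> the semigroup
  itself. Each of the \<open>D\<close> generators contributes at most one to \<open>p\<close> and at
  most one to \<open>q\<close>, hence the bounds.\<close>

definition mval_ge :: "nat \<Rightarrow> nat \<Rightarrow> nat set" where
  "mval_ge k n = {mval k D p q | D p q. n \<le> D \<and> p \<le> D \<and> q \<le> D}"

lemma mval_add: "mval k D p q + mval k D' p' q' = mval k (D + D') (p + p') (q + q')"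
  by (simp add: mval_def algebra_simps)

lemma mval_unit: "mval k (Suc 0) 0 0 = k * (k + 1)"
  by (simp add: mval_def)

lemma mval_geI: "n \<le> D \<Longrightarrow> p \<le> D \<Longrightarrow> q \<le> D \<Longrightarrow> mval k D p q \<in> mval_ge k n"
  by (auto simp: mval_ge_def)

lemma mval_ge_add:
  assumes "x \<in> mval_ge k m" "y \<in> mval_ge k n"
  shows "x + y \<in> mval_ge k (m + n)"
proof -
  obtain D p q D' p' q' where "x = mval k D p q" "m \<le> D" "p \<le> D" "q \<le> D"
    "y = mval k D' p' q'" "n \<le> D'" "p' \<le> D'" "q' \<le> D'"
    using assms by (auto simp: mval_ge_def)
  then show ?thesis by (auto simp: mval_add intro!: mval_geI)
qed

lemma mval_ge_mono: "m \<le> n \<Longrightarrow> mval_ge k n \<subseteq> mval_ge k m"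
  by (force simp: mval_ge_def)

lemma mval_normal_form:
  "mval k (D + p div (k + 1) + 2 * (q div k)) (p mod (k + 1)) (q mod k) = mval k D p q"
proof -
  have p: "p = (k + 1) * (p div (k + 1)) + p mod (k + 1)" and q: "q = k * (q div k) + q mod k"
    by (simp_all only: mult_div_mod_eq)
  \<comment> \<open>Free variables keep \<open>div\<close> and \<open>mod\<close> out of the
    algebra; folding then restores \<open>p\<close> and \<open>q\<close>.\<close>
  have "mval k D ((k + 1) * a + b) (k * c + d) = mval k (D + a + 2 * c) b d" for a b c d
    by (simp add: mval_def algebra_simps)
  from this[of "p div (k + 1)" "p mod (k + 1)" "q div k" "q mod k", folded p q]
  show ?thesis by simp
qed

text \<open>Reduction never raises \<open>p\<close> or \<open>q\<close> and never lowers
  \<open>D\<close>, so all three bounds survive it.\<close>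

lemma mval_ge_normal:
  assumes "k > 0"
  shows "mval_ge k n = {mval k D p q | D p q. n \<le> D \<and> p \<le> D \<and> q \<le> D \<and> p \<le> k \<and> q < k}"
    (is "_ = ?R")
proof
  show "?R \<subseteq> mval_ge k n" by (auto simp: mval_ge_def)
  show "mval_ge k n \<subseteq> ?R"
  proof
    fix x assume "x \<in> mval_ge k n"
    then obtain D p q where x: "x = mval k D p q" "n \<le> D" "p \<le> D" "q \<le> D"
      by (auto simp: mval_ge_def)
    have "p mod (k + 1) \<le> p" "q mod k \<le> q" by simp_all
    then have "p mod (k + 1) \<le> D + p div (k + 1) + 2 * (q div k)"
      "q mod k \<le> D + p div (k + 1) + 2 * (q div k)"
      using x by linarith+
    moreover have "p mod (k + 1) < k + 1" "q mod k < k" using assms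
      by (auto simp del: One_nat_def intro!: mod_less_divisor)
    moreover have "x = mval k (D + p div (k + 1) + 2 * (q div k)) (p mod (k + 1)) (q mod k)"
      by (simp only: mval_normal_form x)
    ultimately show "x \<in> ?R" using x(2) by fastforce
  qed
qed

text \<open>Modulo \<open>k + 1\<close> only \<open>p * k\<close> survives, and \<open>k\<close> is
  a unit; modulo \<open>k\<close> only \<open>2 * q\<close> survives, and 2 is a unit because
  \<open>k\<close> is odd. This fixes \<open>p\<close> and \<open>q\<close>, and then
  \<open>D\<close>.\<close>

lemma mval_eq_iff:
  assumes "odd k" "p \<le> k" "q < k" "p' \<le> k" "q' < k"
  shows "mval k D p q = mval k D' p' q' \<longleftrightarrow> D = D' \<and> p = p' \<and> q = q'"
proof
  assume eq: "mval k D p q = mval k D' p' q'"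
  have k: "k > 0" using assms(3) by simp
  have "[p * k = mval k D p q] (mod (k + 1))" for D p q
  proof -
    have "mval k D p q = p * k + (k + 1) * (D * k + 2 * q)"
      by (simp add: mval_def algebra_simps)
    then show ?thesis by (simp only: cong_def mod_mult_self2)
  qed
  then have "[p * k = p' * k] (mod (k + 1))" using eq by (metis cong_sym cong_trans)
  moreover have "coprime k (k + 1)" by simp
  ultimately have "[p = p'] (mod (k + 1))" by (metis cong_mult_rcancel_nat)
  then have p: "p = p'" using assms by (simp add: cong_def)
  have "[2 * q = mval k D p q] (mod k)" for D p q
  proof -
    have "mval k D p q = 2 * q + k * (D * (k + 1) + p + 2 * q)"
      by (simp add: mval_def algebra_simps)
    then show ?thesis by (simp add: cong_def)
  qed
  then have "[2 * q = 2 * q'] (mod k)" using eq by (metis cong_sym cong_trans)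
  moreover have "coprime 2 k" using assms(1) by simp
  ultimately have "[q = q'] (mod k)" by (metis cong_mult_lcancel_nat)
  then have "q = q'" using assms by (simp add: cong_def)
  with p eq k show "D = D' \<and> p = p' \<and> q = q'" by (simp add: mval_def)
qed simp

text \<open>The reduced triple is unique, so its own entries decide membership.\<close>

lemma mval_mem_mval_ge_iff:
  assumes "odd k" "p \<le> k" "q < k"
  shows "mval k D p q \<in> mval_ge k n \<longleftrightarrow> n \<le> D \<and> p \<le> D \<and> q \<le> D"
proof -
  have "k > 0" using assms by simp
  then show ?thesis using assms mval_eq_iff[OF assms] by (auto simp: mval_ge_normal)
qed

section \<open>The multiples \<open>nM\<close>\<close>

text \<open>\<open>D = 0\<close> forces \<open>p = q = 0\<close> and the value 0, while
  \<open>D \<ge> 1\<close> gives at least \<open>k * (k + 1) > 0\<close>.\<close>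

lemma mval_ge_1:
  assumes "k > 0"
  shows "mval_ge k 0 - {0} = mval_ge k (Suc 0)"
proof -
  have "mval k D p q \<in> mval_ge k (Suc 0)"
    if "mval k D p q \<noteq> 0" "p \<le> D" "q \<le> D" for D p q
    using that by (intro mval_geI) (auto simp: mval_def intro: Suc_leI)
  then have "mval_ge k 0 - {0} \<subseteq> mval_ge k (Suc 0)" by (auto simp: mval_ge_def[of k 0])
  moreover have "0 \<notin> mval_ge k (Suc 0)"
    using assms by (auto simp: mval_ge_def mval_def)
  ultimately show ?thesis using mval_ge_mono[of 0 "Suc 0" k] by auto
qed

lemma sum_list_mem_mval_ge:
  "set xs \<subseteq> mval_ge k (Suc 0) \<Longrightarrow> sum_list xs \<in> mval_ge k (length xs)"
proof (induction xs)
  case Nil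
  show ?case using mval_geI[of 0 0 0 0 k] by (simp add: mval_def)
next
  case (Cons x xs)
  then show ?case using mval_ge_add[of x k "Suc 0"] by simp
qed

lemma mval_ge_Suc_split:
  assumes "x \<in> mval_ge k (Suc n)"
  obtains y z where "x = y + z" "y \<in> mval_ge k (Suc 0)" "z \<in> mval_ge k n"
proof -
  obtain D p q where x: "x = mval k D p q" "Suc n \<le> D" "p \<le> D" "q \<le> D"
    using assms by (auto simp: mval_ge_def)
  \<comment> \<open>One generator is split off: \<open>m3\<close> if \<open>p\<close> and
    \<open>q\<close> are both positive, \<open>m1\<close> or \<open>m2\<close> if only one of them
    is, and \<open>m0\<close> if neither is.\<close>
  have "x = mval k (Suc 0) (min p 1) (min q 1) + mval k (D - 1) (p - 1) (q - 1)"
    using x by (simp add: mval_add min_def)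
  moreover have "mval k (Suc 0) (min p 1) (min q 1) \<in> mval_ge k (Suc 0)"
    by (intro mval_geI) auto
  moreover have "mval k (D - 1) (p - 1) (q - 1) \<in> mval_ge k n"
    using x by (intro mval_geI) auto
  ultimately show ?thesis using that by blast
qed

text \<open>The form \<open>Suc n\<close> matters: \<open>mval_ge k 0\<close> is the whole
  semigroup, while the empty sum is only 0.\<close>

lemma mval_ge_imp_sum_list:
  assumes "x \<in> mval_ge k (Suc n)"
  shows "\<exists>xs. x = sum_list xs \<and> length xs = Suc n \<and> set xs \<subseteq> mval_ge k (Suc 0)"
  using assms
proof (induction n arbitrary: x)
  case 0
  then show ?case by (intro exI[of _ "[x]"]) simp
next
  case (Suc n)
  then obtain y z where yz: "x = y + z" "y \<in> mval_ge k (Suc 0)" "z \<in> mval_ge k (Suc n)"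
    by (blast elim: mval_ge_Suc_split)
  with Suc.IH obtain xs where "z = sum_list xs" "length xs = Suc n" "set xs \<subseteq> mval_ge k (Suc 0)"
    by blast
  with yz show ?case by (intro exI[of _ "y # xs"]) simp
qed

text \<open>At \<open>n = 0\<close> this is the convention for \<open>0M\<close>; otherwise
  additivity of the bound on \<open>D\<close> gives one inclusion and repeated splitting the
  other.\<close>

lemma ideal_multiple_mval_ge:
  assumes "k > 0"
  shows "ideal_multiple (mval_ge k 0) n = mval_ge k n"
proof (cases n)
  case 0
  then show ?thesis by (simp add: ideal_multiple_def)
next
  case (Suc m)
  then show ?thesis
    using mval_ge_imp_sum_list[of _ k m]
    by (auto simp: ideal_multiple_def mval_ge_1[OF assms]) (metis sum_list_mem_mval_ge)
qed

section \<open>The semigroup, its cofiniteness and its multiplicity\<close>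

lemma nonneg_combinations_eq_mval_ge:
  "nonneg_combinations [k * (k + 1), (k + 2) * k, (k + 1) * (k + 2), (k + 1) * (k + 2) + k] = mval_ge k 0"
  (is "nonneg_combinations ?ms = _")
proof -
  have sum: "(\<Sum>i<length ?ms. c i * ?ms ! i) =
      mval k (c 0 + c 1 + c 2 + c 3) (c 1 + c 3) (c 2 + c 3)" for c :: "nat \<Rightarrow> nat"
    by (simp add: eval_nat_numeral mval_def algebra_simps)
  show ?thesis
  proof (intro equalityI subsetI)
    fix x assume "x \<in> nonneg_combinations ?ms"
    then obtain c where "x = (\<Sum>i<length ?ms. c i * ?ms ! i)"
      unfolding nonneg_combinations_def by blast
    then show "x \<in> mval_ge k 0" unfolding sum by (auto intro!: mval_geI)
  next
    fix x assume "x \<in> mval_ge k 0"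
    then obtain D p q where x: "x = mval k D p q" "p \<le> D" "q \<le> D" by (auto simp: mval_ge_def)
    \<comment> \<open>\<open>m3\<close> raises both counts, so it is taken \<open>min p q\<close>
      times; \<open>m1\<close> and \<open>m2\<close> supply the surplus, and \<open>m0\<close> fills
      the total up to \<open>D\<close>.\<close>
    define c where "c = (!) [D - max p q, p - min p q, q - min p q, min p q]"
    have "c 0 + c 1 + c 2 + c 3 = D" "c 1 + c 3 = p" "c 2 + c 3 = q"
      using x by (auto simp: c_def eval_nat_numeral)
    then have "x = (\<Sum>i<length ?ms. c i * ?ms ! i)" unfolding sum x(1) by (simp only:)
    then show "x \<in> nonneg_combinations ?ms" unfolding nonneg_combinations_def by blast
  qed
qed

text \<open>The \<open>k * (k + 1)\<close> reduced pairs give distinct residues modulo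
  \<open>m0\<close>, hence all residues. With \<open>D = k\<close> every reduced pair is admissible,
  so a large number differs from an element of the semigroup by a multiple of \<open>m0\<close>,
  which is absorbed in \<open>D\<close>.\<close>

lemma numerical_semigroup_mval_ge:
  assumes "odd k"
  shows "numerical_semigroup (mval_ge k 0)"
proof -
  let ?m = "k * (k + 1)" and ?S = "{..k} \<times> {..<k}"
  have k: "k > 0" using assms by (rule odd_pos)
  have eqD: "mval k D p q = D * ?m + mval k 0 p q" for D p q by (simp add: mval_def)
  define f where "f = (\<lambda>(p, q). mval k 0 p q mod ?m)"
  have inj: "inj_on f ?S"
  proof (rule inj_onI, clarsimp simp: f_def simp del: mult_Suc_right)
    fix p q p' q'
    assume *: "p \<le> k" "q < k" "p' \<le> k" "q' < k"
      "mval k 0 p q mod (k * Suc k) = mval k 0 p' q' mod (k * Suc k)"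
    \<comment> \<open>Each value is raised by \<open>m0\<close> times the quotient of the other;
      equal remainders make the results equal, without any subtraction.\<close>
    then have "mval k (mval k 0 p' q' div ?m) p q = mval k (mval k 0 p q div ?m) p' q'"
      unfolding eqD[of "_ div _"]
      by (metis add.assoc add.commute div_mult_mod_eq Suc_eq_plus1)
    then show "p = p' \<and> q = q'" using mval_eq_iff[OF assms] * by metis
  qed
  have "f ` ?S \<subseteq> {..<?m}" using k by (auto simp: f_def simp del: mult_Suc_right)
  moreover have "card (f ` ?S) = card {..<?m}"
    using card_image[OF inj] by (simp add: card_cartesian_product)
  ultimately have surj: "f ` ?S = {..<?m}" by (intro card_subset_eq) auto
  have "x \<in> mval_ge k 0" if x: "mval k k k k \<le> x" for x
  proof -
    have "x mod ?m \<in> f ` ?S" unfolding surj using k by simp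
    then obtain p q where pq: "p \<le> k" "q < k" "mval k 0 p q mod ?m = x mod ?m"
      by (auto simp: f_def simp del: mult_Suc_right)
    have le: "mval k k p q \<le> mval k k k k"
      unfolding mval_def using pq by (intro add_mono mult_mono) auto
    have "mval k k p q mod ?m = x mod ?m" using pq(3) unfolding eqD[of k] by simp
    moreover have lex: "mval k k p q \<le> x" using le x by linarith
    ultimately have "?m dvd x - mval k k p q" by (metis mod_eq_dvd_iff_nat)
    then obtain e where "x - mval k k p q = ?m * e" by (elim dvdE)
    then have "x = mval k k p q + ?m * e" using lex by linarith
    then have "x = mval k (k + e) p q" by (simp add: mval_def algebra_simps)
    then show ?thesis using pq by (auto intro: mval_geI)
  qed
  then have "UNIV - mval_ge k 0 \<subseteq> {..<mval k k k k}" by (meson DiffD2 lessThan_iff not_le subsetI)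
  then have "finite (UNIV - mval_ge k 0)" by (rule finite_subset) simp
  moreover have "0 \<in> mval_ge k 0" using sum_list_mem_mval_ge[of "[]" k] by simp
  ultimately show ?thesis
    using mval_ge_add[of _ k 0 _ 0] by (auto simp: numerical_semigroup_def)
qed

lemma multiplicity_of_mval_ge:
  assumes "k > 0"
  shows "multiplicity_of (mval_ge k 0) = k * (k + 1)"
proof -
  have *: "x \<in> mval_ge k 0 \<and> x \<noteq> 0 \<longleftrightarrow> x \<in> mval_ge k (Suc 0)" for x
    unfolding mval_ge_1[OF assms, symmetric] by simp
  show ?thesis unfolding multiplicity_of_def *
  proof (rule Least_equality)
    show "k * (k + 1) \<in> mval_ge k (Suc 0)"
      using mval_geI[of "Suc 0" "Suc 0" 0 0 k] by (simp add: mval_unit)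
  next
    fix y assume "y \<in> mval_ge k (Suc 0)"
    then obtain D p q where "y = mval k D p q" "Suc 0 \<le> D" by (auto simp: mval_ge_def)
    moreover from this have "1 * (k * (k + 1)) \<le> D * (k * (k + 1))" by (intro mult_right_mono) auto
    ultimately show "k * (k + 1) \<le> y" unfolding mval_def by linarith
  qed
qed

section \<open>Apery set and reduction number\<close>

text \<open>Adding \<open>m0\<close> raises \<open>D\<close> by one and keeps \<open>p\<close> and
  \<open>q\<close>, which makes the bounds strict.\<close>

lemma shift_mval_ge:
  assumes "k > 0"
  shows "(\<lambda>x. k * (k + 1) + x) ` mval_ge k n =
    {mval k D p q | D p q. n < D \<and> p < D \<and> q < D \<and> p \<le> k \<and> q < k}" (is "?L = ?R")
proof
  show "?L \<subseteq> ?R"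
    unfolding mval_ge_normal[OF assms] mval_unit[symmetric]
    by (auto simp: mval_add) (metis le_imp_less_Suc)
  show "?R \<subseteq> ?L"
  proof
    fix x assume "x \<in> ?R"
    then obtain D p q where x: "x = mval k D p q" "n < D" "p < D" "q < D" by auto
    then have "x = k * (k + 1) + mval k (D - 1) p q"
      unfolding mval_unit[symmetric] mval_add by simp
    moreover have "mval k (D - 1) p q \<in> mval_ge k n" using x by (intro mval_geI) auto
    ultimately show "x \<in> ?L" by blast
  qed
qed

text \<open>In reduced form, an element fails to be a shift by \<open>m0\<close> exactly if
  \<open>p\<close> or \<open>q\<close> attains the bound \<open>D\<close>.\<close>

lemma apery_set_mval_ge:
  assumes "odd k"
  shows "apery_set (mval_ge k 0) (k * (k + 1)) = (\<lambda>(p, q). mval k (max p q) p q) ` ({..k} \<times> {..<k})"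
proof -
  have k: "k > 0" using assms by (rule odd_pos)
  have iff: "int s - int (k * (k + 1)) \<in> int ` mval_ge k 0 \<longleftrightarrow>
      s \<in> (\<lambda>x. k * (k + 1) + x) ` mval_ge k 0" for s
  proof -
    have "int s - int (k * (k + 1)) = int x \<longleftrightarrow> s = k * (k + 1) + x" for x by linarith
    then show ?thesis by (simp add: image_iff)
  qed
  have shift: "mval k D p q \<in> (\<lambda>x. k * (k + 1) + x) ` mval_ge k 0 \<longleftrightarrow> p < D \<and> q < D"
    if "p \<le> k" "q < k" for D p q
    unfolding shift_mval_ge[OF k] using that mval_eq_iff[OF assms that] by fastforce
  show ?thesis
  proof (intro equalityI subsetI)
    fix s assume s: "s \<in> apery_set (mval_ge k 0) (k * (k + 1))"
    then have "s \<in> mval_ge k 0" by (simp add: apery_set_def)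
    then obtain D p q where x: "s = mval k D p q" "p \<le> D" "q \<le> D" "p \<le> k" "q < k"
      unfolding mval_ge_normal[OF k] by auto
    have "s \<notin> (\<lambda>x. k * (k + 1) + x) ` mval_ge k 0" using s unfolding apery_set_def iff by blast
    then have "\<not> (p < D \<and> q < D)" unfolding x(1) shift[OF x(4,5)] .
    then have "D = max p q" using x by auto
    then show "s \<in> (\<lambda>(p, q). mval k (max p q) p q) ` ({..k} \<times> {..<k})" using x by auto
  next
    fix s assume "s \<in> (\<lambda>(p, q). mval k (max p q) p q) ` ({..k} \<times> {..<k})"
    then obtain p q where s: "s = mval k (max p q) p q" "p \<le> k" "q < k" by auto
    have "s \<in> mval_ge k 0" unfolding s(1) by (intro mval_geI) auto
    moreover have "s \<notin> (\<lambda>x. k * (k + 1) + x) ` mval_ge k 0" unfolding s(1) shift[OF s(2,3)] by auto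
    ultimately show "s \<in> apery_set (mval_ge k 0) (k * (k + 1))"
      unfolding apery_set_def iff by blast
  qed
qed

text \<open>For \<open>k \<le> r\<close> the strict bounds hold automatically for reduced pairs; for
  smaller \<open>r\<close> a multiple of \<open>m1\<close> separates the two sets.\<close>

lemma reduction_number_mval_ge:
  assumes "odd k"
  shows "reduction_number (mval_ge k 0) (k * (k + 1)) = k"
proof -
  have k: "k > 0" using assms by (rule odd_pos)
  have "mval_ge k (r + 1) = (\<lambda>x. k * (k + 1) + x) ` mval_ge k r \<longleftrightarrow> k \<le> r" for r
  proof
    assume "k \<le> r"
    then have eq: "r + 1 \<le> D \<and> p \<le> D \<and> q \<le> D \<and> p \<le> k \<and> q < k \<longleftrightarrow>
        r < D \<and> p < D \<and> q < D \<and> p \<le> k \<and> q < k" for D p q :: nat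
      by auto
    show "mval_ge k (r + 1) = (\<lambda>x. k * (k + 1) + x) ` mval_ge k r"
      unfolding shift_mval_ge[OF k] by (simp only: mval_ge_normal[OF k] eq)
  next
    assume *: "mval_ge k (r + 1) = (\<lambda>x. k * (k + 1) + x) ` mval_ge k r"
    show "k \<le> r"
    proof (rule ccontr)
      assume r: "\<not> k \<le> r"
      \<comment> \<open>This is \<open>(r + 1) * m1\<close>, already reduced as
        \<open>r + 1 \<le> k\<close>; its \<open>p\<close> equals \<open>D\<close>, so it is not a
        shift.\<close>
      have "mval k (r + 1) (r + 1) 0 \<in> mval_ge k (r + 1)" by (intro mval_geI) auto
      then obtain D p q where "mval k (r + 1) (r + 1) 0 = mval k D p q"
        "p < D" "p \<le> k" "q < k"
        unfolding * shift_mval_ge[OF k] by auto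
      then show False using mval_eq_iff[OF assms, of "r + 1" 0 p q "r + 1" D] r k by auto
    qed
  qed
  then have "reduction_number (mval_ge k 0) (k * (k + 1)) = (LEAST r. k \<le> r)"
    unfolding reduction_number_def ideal_multiple_mval_ge[OF k] by simp
  also have "\<dots> = k" by (rule Least_equality) auto
  finally show ?thesis .
qed

section \<open>Entries of the Apery table\<close>

text \<open>From row 1 on, \<open>m0\<close> is added exactly when \<open>D\<close> is too small for
  the next multiple of \<open>M\<close>, and this raises \<open>D\<close> by one. So
  \<open>D\<close> stays at \<open>max p q\<close> until the row number overtakes it, and then
  equals the row number.\<close>

lemma apery_entry_mval_ge:
  assumes "odd k" "p \<le> k" "q < k" "\<omega> t = mval k (max p q) p q" "t = 0 \<longleftrightarrow> p = 0 \<and> q = 0"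
  shows "apery_entry (mval_ge k 0) (k * (k + 1)) \<omega> s t = mval k (max s (max p q)) p q"
proof -
  have k: "k > 0" using assms(1) by (rule odd_pos)
  have Suc: "apery_entry (mval_ge k 0) (k * (k + 1)) \<omega> (Suc n) t = mval k (max (Suc n) (max p q)) p q" for n
  proof (induction n)
    case 0
    show ?case
    \<comment> \<open>The triple with \<open>D = 1\<close> and \<open>p = q = 0\<close> is
      \<open>m0\<close>, which replaces 0 in row 1; in the other columns \<open>max p q\<close> is
      already positive.\<close>
    proof (cases "t = 0")
      case True
      then show ?thesis using assms(5) mval_unit[of k] by simp
    next
      case False
      then have "max (Suc 0) (max p q) = max p q" using assms(5) by auto
      then show ?thesis using False assms(4) by simp
    qed
  next
    case (Suc n)
    let ?D = "max (Suc n) (max p q)"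
    have mem: "mval k ?D p q \<in> mval_ge k (Suc (Suc n)) \<longleftrightarrow> Suc (Suc n) \<le> max p q"
      unfolding mval_mem_mval_ge_iff[OF assms(1-3)] by auto
    have add: "mval k ?D p q + k * (k + 1) = mval k (Suc ?D) p q"
      unfolding mval_unit[symmetric] mval_add by simp
    have "Suc ?D = max (Suc (Suc n)) (max p q)" if "\<not> Suc (Suc n) \<le> max p q"
      using that by auto
    moreover have "?D = max (Suc (Suc n)) (max p q)" if "Suc (Suc n) \<le> max p q"
      using that by auto
    ultimately show ?case
      unfolding apery_entry.simps Suc.IH ideal_multiple_mval_ge[OF k] mem add by presburger
  qed
  show ?thesis
  proof (cases s)
    case 0
    then show ?thesis using assms(4) by simp
  next
    case (Suc n)
    then show ?thesis by (simp only: Suc \<open>\<And>n. apery_entry _ _ \<omega> (Suc n) t = _\<close>)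
  qed
qed

section \<open>The order of the columns\<close>

text \<open>The pairs \<open>(p, q)\<close> in the order in which the columns appear in the blocks \<open>T0, \<dots>, T5\<close>.\<close>

definition column_index :: "nat \<Rightarrow> (nat \<times> nat) list" where
  "column_index k =
     [(0, 0)] @ map (\<lambda>j. (j, 0)) [1..<k + 1] @ map (\<lambda>j. (0, j)) [1..<k]
       @ map (\<lambda>j. (j, j)) [1..<k]
       @ concat (map (\<lambda>i. map (\<lambda>s. (i + s, s)) [1..<(k - i) + 1]) [1..<k])
       @ concat (map (\<lambda>i. map (\<lambda>s. (s, i + s)) [1..<(k - 1 - i) + 1]) [1..<k - 1])"

lemma set_column_index:
  assumes "k > 0"
  shows "set (column_index k) = {..k} \<times> {..<k}"
proof -
  have eq: "set (column_index k) =
      {(0, 0)} \<union> (\<lambda>j. (j, 0)) ` {1..<k + 1} \<union> (\<lambda>j. (0, j)) ` {1..<k} \<union> (\<lambda>j. (j, j)) ` {1..<k}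
      \<union> (\<Union>i\<in>{1..<k}. (\<lambda>s. (i + s, s)) ` {1..<(k - i) + 1})
      \<union> (\<Union>i\<in>{1..<k - 1}. (\<lambda>s. (s, i + s)) ` {1..<(k - 1 - i) + 1})" (is "_ = ?R")
    unfolding column_index_def set_append set_map set_concat set_upt image_image Un_assoc by simp
  show ?thesis unfolding eq
  proof (intro equalityI subsetI)
    fix x assume "x \<in> {..k} \<times> {..<k}"
    then obtain p q where pq: "x = (p, q)" "p \<le> k" "q < k" by auto
    \<comment> \<open>The cases correspond to the blocks: first \<open>T0\<close> together with
      \<open>T1\<close>, then \<open>T2\<close>, \<open>T3\<close>, \<open>T4\<close>,
      \<open>T5\<close>.\<close>
    consider "q = 0" | "p = 0" "q > 0" | "p = q" "q > 0" | "0 < q" "q < p" | "0 < p" "p < q"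
      by (cases p q rule: linorder_cases; cases "p = 0"; cases "q = 0") simp_all
    then show "x \<in> ?R"
    proof cases
      case 4
      then have "p - q \<in> {1..<k}" "q \<in> {1..<k - (p - q) + 1}" "x = ((p - q) + q, q)"
        using pq by auto
      then show ?thesis by blast
    next
      case 5
      then have "q - p \<in> {1..<k - 1}" "p \<in> {1..<k - 1 - (q - p) + 1}" "x = (p, (q - p) + p)"
        using pq by auto
      then show ?thesis by blast
    qed (use pq in \<open>auto simp: image_iff\<close>)
  qed (use assms in auto)
qed

text \<open>Adds up the shrinking widths of the sub-blocks of \<open>T4\<close>
  (\<open>n = k\<close>) and \<open>T5\<close> (\<open>n = k - 1\<close>), doubled to avoid
  division.\<close>

lemma sum_list_triangle: "2 * (\<Sum>i\<leftarrow>[1..<n]. n - i) = n * (n - 1)"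
proof (induction n)
  case (Suc n)
  show ?case
  proof (cases n)
    case (Suc m)
    then have "[1..<Suc n] = 1 # map Suc [1..<n]"
      by (simp add: upt_conv_Cons map_Suc_upt del: upt_Suc)
    then have "(\<Sum>i\<leftarrow>[1..<Suc n]. Suc n - i) = n + (\<Sum>i\<leftarrow>[1..<n]. n - i)"
      by (simp add: comp_def del: upt_Suc)
    then show ?thesis using Suc.IH Suc by (simp add: algebra_simps del: upt_Suc)
  qed simp
qed simp

lemma length_column_index:
  assumes "k > 0"
  shows "length (column_index k) = k * (k + 1)"
proof -
  obtain m where m: "k = Suc m" using assms by (cases k) auto
  have "length (column_index k) = 1 + k + 2 * m
      + (\<Sum>i\<leftarrow>[1..<k]. k - i) + (\<Sum>i\<leftarrow>[1..<m]. m - i)"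
    by (simp add: column_index_def length_concat comp_def m del: upt_Suc)
  moreover have "2 * (\<Sum>i\<leftarrow>[1..<k]. k - i) = (m + 1) * m"
    using sum_list_triangle[of k] by (simp add: m del: upt_Suc)
  \<comment> \<open>Adding \<open>m\<close> removes the truncated difference
    \<open>m - 1\<close>.\<close>
  moreover have "2 * (\<Sum>i\<leftarrow>[1..<m]. m - i) + m = m * m"
    using sum_list_triangle[of m] by (cases m) auto
  ultimately have "2 * length (column_index k) = 2 * (k * (k + 1))"
    by (simp add: m algebra_simps del: upt_Suc)
  then show ?thesis by simp
qed

text \<open>The length equals the number of reduced pairs, so covering all of them leaves no room
  for repetitions.\<close>

lemma distinct_column_index: "k > 0 \<Longrightarrow> distinct (column_index k)"
  by (rule card_distinct)
    (simp add: set_column_index length_column_index card_cartesian_product)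

section \<open>Columns of block matrices\<close>

text \<open>The range \<open>[1..<nc + 1]\<close> matches the ranges in \<open>column_index\<close>,
  so blocks can be compared as lists of columns.\<close>

lemma cols_mat_from_1:
  "cols (mat_from_1 nr nc f) = map (\<lambda>j. vec nr (\<lambda>i. f (i + 1) j)) [1..<nc + 1]"
proof -
  have "[1..<nc + 1] = map Suc [0..<nc]" by (simp add: map_Suc_upt del: upt_Suc)
  then show ?thesis by (auto simp: cols_def mat_from_1_def col_def simp del: upt_Suc)
qed

lemma cols_block_row:
  assumes "\<And>A. A \<in> set As \<Longrightarrow> dim_row A = nr"
  shows "cols (block_row nr As) = concat (map cols As)"
  unfolding block_row_def
proof (rule cols_mat_of_cols)
  show "set (concat (map cols As)) \<subseteq> carrier_vec nr"
    using assms cols_dim by (fastforce simp: subset_iff)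
qed

lemma dim_mat_from_1 [simp]: "dim_row (mat_from_1 nr nc f) = nr" "dim_col (mat_from_1 nr nc f) = nc"
  by (simp_all add: mat_from_1_def)

lemma dim_block_row [simp]:
  "dim_row (block_row nr As) = nr" "dim_col (block_row nr As) = (\<Sum>A\<leftarrow>As. dim_col A)"
  by (simp_all add: block_row_def length_concat comp_def)

section \<open>The Apery table in terms of reduced pairs\<close>

definition column_entry :: "nat \<Rightarrow> nat \<Rightarrow> nat \<times> nat \<Rightarrow> nat" where
  "column_entry k s = (\<lambda>(p, q). mval k (max s (max p q)) p q)"

text \<open>Row 0 has \<open>D = max p q\<close>; as the list runs exactly once through the reduced
  pairs, this row enumerates the Apery set. It then remains to bring the block matrix into the form
  \<open>B\<close>.\<close>

lemma apery_table_mval_ge: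
  fixes k :: nat
  defines "B \<equiv> mat (k + 1) (k * (k + 1)) (\<lambda>(s, t). column_entry k s (column_index k ! t))"
  assumes "odd k"
  shows "apery_enumeration (mval_ge k 0) (k * (k + 1)) (\<lambda>t. B $$ (0, t))"
    and "apery_table (mval_ge k 0) (k * (k + 1)) (\<lambda>t. B $$ (0, t)) = B"
proof -
  let ?\<omega> = "\<lambda>t. B $$ (0, t)" and ?m = "k * (k + 1)"
  have k: "k > 0" using assms(2) by (rule odd_pos)
  have \<omega>: "?\<omega> t = column_entry k 0 (column_index k ! t)" if "t < ?m" for t
    using that by (simp add: B_def)
  have nth0: "column_index k ! 0 = (0, 0)" by (simp add: column_index_def)
  have nth: "bij_betw ((!) (column_index k)) {..<?m} ({..k} \<times> {..<k})"
    using bij_betw_nth[OF distinct_column_index[OF k] _ refl]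
    by (simp add: length_column_index[OF k] set_column_index[OF k])
  have "inj_on (column_entry k 0) ({..k} \<times> {..<k})"
    by (auto simp: inj_on_def column_entry_def mval_eq_iff[OF assms(2)])
  then have "bij_betw (column_entry k 0) ({..k} \<times> {..<k}) (apery_set (mval_ge k 0) ?m)"
    unfolding apery_set_mval_ge[OF assms(2)] by (simp add: bij_betw_def column_entry_def)
  from bij_betw_trans[OF nth this] have "bij_betw ?\<omega> {..<?m} (apery_set (mval_ge k 0) ?m)"
    by (rule bij_betw_cong[THEN iffD1, rotated]) (simp add: \<omega> del: mult_Suc_right)
  moreover have "?\<omega> 0 = 0" using k \<omega>[of 0] by (simp add: nth0 column_entry_def mval_def)
  ultimately show "apery_enumeration (mval_ge k 0) ?m ?\<omega>"
    by (simp add: apery_enumeration_def)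
  have "apery_entry (mval_ge k 0) ?m ?\<omega> s t = column_entry k s (column_index k ! t)"
    if t: "t < ?m" for s t
  proof -
    obtain p q where pq: "column_index k ! t = (p, q)" by fastforce
    have "(p, q) \<in> {..k} \<times> {..<k}" using bij_betwE[OF nth] t pq by force
    then have "p \<le> k" "q < k" by auto
    \<comment> \<open>The list is distinct, so only column 0 carries the pair \<open>(0, 0)\<close>;
      row 1 treats exactly this column differently.\<close>
    moreover have "t = 0 \<longleftrightarrow> p = 0 \<and> q = 0"
      using bij_betw_imp_inj_on[OF nth, THEN inj_on_eq_iff, of t 0] t k pq nth0 by auto
    moreover have "?\<omega> t = mval k (max p q) p q"
      using \<omega>[OF t] by (simp add: pq column_entry_def)
    ultimately show ?thesis
      using apery_entry_mval_ge[OF assms(2), of p q ?\<omega> t s] by (simp add: pq column_entry_def)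
  qed
  then show "apery_table (mval_ge k 0) ?m ?\<omega> = B"
    unfolding apery_table_def reduction_number_mval_ge[OF assms(2)]
    by (subst B_def) (auto intro!: cong_mat simp del: mult_Suc_right)
qed

section \<open>Identification of the block matrix\<close>

theorem theorem3p4:
  fixes h m0 m1 m2 m3 :: nat
    and \<Gamma> :: "nat set"
    and T0 T1 T2 T3 T4 T5 B :: "nat mat"
    and \<omega> :: "nat \<Rightarrow> nat"
  assumes "h \<ge> 2"
    and "m0 = 2 * h * (2 * h - 1)"
    and "m1 = (2 * h + 1) * (2 * h - 1)"
    and "m2 = 2 * h * (2 * h + 1)"
    and "m3 = 2 * h * (2 * h + 1) + (2 * h - 1)"
    and "\<Gamma> = nonneg_combinations [m0, m1, m2, m3]"
    and "T0 = mat_from_1 (2 * h) 1 (\<lambda>i j. (i - 1) * m0)"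
    and "T1 = mat_from_1 (2 * h) (2 * h - 1)
           (\<lambda>i j. if i \<le> j + 1 then j * m1 else j * m1 + (i - j - 1) * m0)"
    and "T2 = mat_from_1 (2 * h) (2 * h - 2)
           (\<lambda>i j. if i \<le> j + 1 then j * m2 else j * m2 + (i - j - 1) * m0)"
    and "T3 = mat_from_1 (2 * h) (2 * h - 2)
           (\<lambda>i j. if i \<le> j + 1 then j * m3 else j * m3 + (i - j - 1) * m0)"
    and "T4 = block_row (2 * h) (map (\<lambda>i. mat_from_1 (2 * h) (2 * h - 1 - i)
           (\<lambda>r s. if r \<le> i + s + 1 then i * m1 + s * m3
                  else i * m1 + s * m3 + (r - i - s - 1) * m0)) [1..<(2 * h - 2) + 1])"
    and "T5 = block_row (2 * h) (map (\<lambda>i. mat_from_1 (2 * h) (2 * h - 2 - i)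
           (\<lambda>r s. if r \<le> i + s + 1 then i * m2 + s * m3
                  else i * m2 + s * m3 + (r - i - s - 1) * m0)) [1..<(2 * h - 3) + 1])"
    and "B = block_row (2 * h) [T0, T1, T2, T3, T4, T5]"
    and "\<omega> = (\<lambda>t. B $$ (0, t))"
  shows "numerical_semigroup \<Gamma> \<and> multiplicity_of \<Gamma> = m0
    \<and> apery_enumeration \<Gamma> m0 \<omega>
    \<and> T4 \<in> carrier_mat (2 * h) ((h - 1) * (2 * h - 1))
    \<and> T5 \<in> carrier_mat (2 * h) ((h - 1) * (2 * h - 3))
    \<and> apery_table \<Gamma> m0 \<omega> \<in> carrier_mat (2 * h) m0
    \<and> apery_table \<Gamma> m0 \<omega> = B"
proof -
  define k where "k = 2 * h - 1"
  have k: "odd k" "k \<ge> 3" "k > 0" using assms(1) by (auto simp: k_def)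
  have h: "2 * h = k + 1" "k + 1 - 1 = k" "k + 1 + 1 = k + 2" "k + 1 - 2 = k - 1" "k + 1 - 3 = k - 2"
    "k - 1 + 1 = k" "k - 2 + 1 = k - 1"
    using assms(1) by (auto simp: k_def)
  have m: "m0 = k * (k + 1)" "m1 = (k + 2) * k" "m2 = (k + 1) * (k + 2)" "m3 = (k + 1) * (k + 2) + k"
    using assms(2-5) unfolding h by simp_all
  have \<Gamma>: "\<Gamma> = mval_ge k 0"
    using assms(6) unfolding m nonneg_combinations_eq_mval_ge .
  note T = assms(7-12)[unfolded h]
  define C where "C = (\<lambda>pq. vec (k + 1) (\<lambda>s. column_entry k s pq))"
  \<comment> \<open>\<open>d\<close> is the number of generators in \<open>x\<close>. Here
    \<open>s\<close> counts rows from 0, so \<open>s + 1\<close> is the row number of the claim;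
    beyond the threshold, \<open>s - d\<close> copies of \<open>m0\<close> lift \<open>D\<close>
    from \<open>d\<close> to \<open>s\<close>.\<close>
  have entry: "(if s + 1 \<le> d + 1 then x else x + (s + 1 - d - 1) * m0) = column_entry k s (p, q)"
    if "x = mval k d p q" "d = max p q" for s d x p q
  proof (cases "s \<le> d")
    case True
    then show ?thesis using that by (simp add: column_entry_def)
  next
    case False
    then obtain e where "s = d + e" "e > 0" by (metis less_imp_add_positive not_le)
    moreover from this have "max s (max p q) = d + e" using that(2) by auto
    ultimately show ?thesis using that(1) by (simp add: column_entry_def mval_def m algebra_simps)
  qed
  have entry2: "(if s + 1 \<le> i + j + 1 then x else x + (s + 1 - i - j - 1) * m0) = column_entry k s (p, q)"
    if "x = mval k (i + j) p q" "i + j = max p q" for s i j x p q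
    using entry[OF that, of s] by (simp split: if_splits)
  have "s * m0 = column_entry k s (0, 0)" for s
    by (simp add: column_entry_def mval_def m)
  then have T0: "cols T0 = map C [(0, 0)]"
    unfolding T(1) cols_mat_from_1 C_def by (simp del: vec_eq_iff)
  have T1: "cols T1 = map C (map (\<lambda>j. (j, 0)) [1..<k + 1])"
    unfolding T(2) cols_mat_from_1 C_def map_map comp_def
    by (intro map_cong refl arg_cong[where f = "vec _"] ext entry)
      (auto simp: mval_def m algebra_simps)
  have T2: "cols T2 = map C (map (\<lambda>j. (0, j)) [1..<k])"
    unfolding T(3) cols_mat_from_1 C_def map_map comp_def h
    by (intro map_cong refl arg_cong[where f = "vec _"] ext entry)
      (auto simp: mval_def m algebra_simps)
  have T3: "cols T3 = map C (map (\<lambda>j. (j, j)) [1..<k])"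
    unfolding T(4) cols_mat_from_1 C_def map_map comp_def h
    by (intro map_cong refl arg_cong[where f = "vec _"] ext entry)
      (auto simp: mval_def m algebra_simps)
  \<comment> \<open>In \<open>i * m1 + s * m3\<close> all \<open>i + s\<close> generators raise
    \<open>p\<close> and \<open>s\<close> of them raise \<open>q\<close>; in \<open>T5\<close>, with
    \<open>m2\<close> for \<open>m1\<close>, the roles of \<open>p\<close> and \<open>q\<close> are
    exchanged.\<close>
  have T4: "cols T4 = map C (concat (map (\<lambda>i. map (\<lambda>s. (i + s, s)) [1..<(k - i) + 1]) [1..<k]))"
    unfolding T(5) map_concat map_map comp_def C_def
    by (subst cols_block_row, force, unfold cols_mat_from_1 map_map comp_def,
      intro arg_cong[where f = concat] map_cong refl arg_cong[where f = "vec _"] ext entry2)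
      (auto simp: mval_def m algebra_simps)
  have T5: "cols T5 = map C (concat (map (\<lambda>i. map (\<lambda>s. (s, i + s)) [1..<(k - 1 - i) + 1]) [1..<k - 1]))"
    unfolding T(6) map_concat map_map comp_def C_def
    by (subst cols_block_row, force, unfold cols_mat_from_1 map_map comp_def,
      intro arg_cong[where f = concat] map_cong refl arg_cong[where f = "vec _"] ext entry2)
      (auto simp: mval_def m algebra_simps)
  have "B = mat_of_cols (k + 1) (map C (column_index k))"
    unfolding assms(13) block_row_def h column_index_def by (simp add: T0 T1 T2 T3 T4 T5 del: upt_Suc)
  also have "\<dots> = mat (k + 1) (k * (k + 1)) (\<lambda>(s, t). column_entry k s (column_index k ! t))"
    using length_column_index[OF k(3)]
    by (auto simp: mat_of_cols_def C_def intro!: cong_mat)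
  finally have B: "B = mat (k + 1) (k * (k + 1)) (\<lambda>(s, t). column_entry k s (column_index k ! t))" .
  \<comment> \<open>\<open>k - 1\<close> is even, which turns the doubled widths into the stated
    numbers of columns.\<close>
  have hk: "k - 1 = 2 * (h - 1)" by (simp add: k_def)
  have "2 * dim_col T4 = k * (k - 1)"
    using sum_list_triangle[of k] unfolding T(5) by (simp add: comp_def)
  then have "dim_col T4 = (h - 1) * k" unfolding hk by simp
  moreover have "2 * dim_col T5 = (k - 1) * (k - 2)"
    using sum_list_triangle[of "k - 1"] unfolding T(6) by (simp add: comp_def numeral_2_eq_2)
  then have "dim_col T5 = (h - 1) * (k - 2)" unfolding hk by simp
  moreover have "dim_row T4 = k + 1" "dim_row T5 = k + 1" unfolding T(5,6) by simp_all
  moreover have table: "apery_table \<Gamma> m0 \<omega> = B"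
    unfolding assms(14) B \<Gamma> m(1) by (rule apery_table_mval_ge(2)[OF k(1)])
  moreover have "apery_table \<Gamma> m0 \<omega> \<in> carrier_mat (k + 1) m0"
    unfolding table unfolding B m(1) by simp
  moreover have "apery_enumeration \<Gamma> m0 \<omega>"
    unfolding assms(14) B \<Gamma> m(1) by (rule apery_table_mval_ge(1)[OF k(1)])
  moreover have "numerical_semigroup \<Gamma>" "multiplicity_of \<Gamma> = m0"
    unfolding \<Gamma> m(1) by (rule numerical_semigroup_mval_ge[OF k(1)] multiplicity_of_mval_ge[OF k(3)])+
  ultimately show ?thesis unfolding h by (blast intro: carrier_matI)
qed

end
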